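(* Let $z=a+jb\in\mathbb{Z}[j]$ be a Gaussian integer. If its matrix representation $\left(\begin{array}{cc} a & -b\\ b & a\end{array}\right)$ is a prime $2\times 2$ integer matrix, then $z$ is a Gaussian prime. The converse does not hold in general: there exists a Gaussian prime whose matrix representation is not a prime matrix.
   Context: $j=\sqrt{-1}$ and $\mathbb{Z}[j]$ is the ring of Gaussian integers $a+jb$ with $a,b\in\mathbb{Z}$. A Gaussian integer is a unit if its absolute value is $1$. A Gaussian integer is a Gaussian prime if it cannot be factored as a product of two non-unit Gaussian integers (units are thus counted as prime). An integer matrix is unimodular if its determinant is $\pm1$, and non-unimodular otherwise. A nonsingular integer matrix is called prime if it cannot be factorized as a product of two non-unimodular integer matrices (unimodular matrices are thus counted as prime). *)

theory Defs
  imports "HOL-Analysis.Analysis"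
begin

definition gaussian_ints :: "complex set"
  where "gaussian_ints = {of_int a + \<i> * of_int b | a b. True}"

definition gaussian_unit :: "complex \<Rightarrow> bool"
  where "gaussian_unit z \<longleftrightarrow> z \<in> gaussian_ints \<and> cmod z = 1"

(* Unlike the library's prime and irreducible, this counts units as prime.
   It excludes 0 = 0 * 0. *)
definition gaussian_prime :: "complex \<Rightarrow> bool"
  where "gaussian_prime z \<longleftrightarrow> z \<in> gaussian_ints \<and>
    \<not> (\<exists>u\<in>gaussian_ints. \<exists>v\<in>gaussian_ints.
          \<not> gaussian_unit u \<and> \<not> gaussian_unit v \<and> z = u * v)"

definition unimodular :: "int ^ 'n ^ 'n \<Rightarrow> bool"
  where "unimodular A \<longleftrightarrow> det A = 1 \<or> det A = - 1"

(* Unimodular matrices count as prime. *)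
definition prime_matrix :: "int ^ 'n ^ 'n \<Rightarrow> bool"
  where "prime_matrix A \<longleftrightarrow> det A \<noteq> 0 \<and>
    \<not> (\<exists>B C. \<not> unimodular B \<and> \<not> unimodular C \<and> A = B ** C)"

definition gaussian_matrix :: "int \<Rightarrow> int \<Rightarrow> int ^ 2 ^ 2"
  where "gaussian_matrix a b = vector [vector [a, - b], vector [b, a]]"

end

theory Submission
  imports Defs
begin

text \<open>The matrix representation is multiplicative and its determinant is the norm, so a factorization
  of a Gaussian integer into non-units is a factorization of its matrix into non-unimodular
  matrices. For the converse take 3: a factor in a proper factorization would have norm 3, which is
  not a sum of two squares, whereas diag(3, 3) = diag(3, 1) diag(1, 3), whose factors do not
  represent Gaussian integers.\<close>

lemma gaussian_unit_iff:
  "gaussian_unit (of_int a + \<i> * of_int b) \<longleftrightarrow> a\<^sup>2 + b\<^sup>2 = 1"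
proof -
  have "cmod (of_int a + \<i> * of_int b) = 1 \<longleftrightarrow> (of_int a)\<^sup>2 + (of_int b)\<^sup>2 = (1::real)"
    by (simp add: cmod_def)
  also have "\<dots> \<longleftrightarrow> real_of_int (a\<^sup>2 + b\<^sup>2) = of_int 1"
    by simp
  also have "\<dots> \<longleftrightarrow> a\<^sup>2 + b\<^sup>2 = 1"
    by (rule of_int_eq_iff)
  finally show ?thesis
    unfolding gaussian_unit_def gaussian_ints_def by blast
qed

lemma det_gaussian_matrix: "det (gaussian_matrix a b) = a\<^sup>2 + b\<^sup>2"
  by (simp add: gaussian_matrix_def det_2 power2_eq_square)

text \<open>The determinant is the norm, a sum of two squares, so of the two values that
  \<open>unimodular\<close> allows only 1 can occur.\<close>

lemma unimodular_gaussian_matrix_iff: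
  "unimodular (gaussian_matrix a b) \<longleftrightarrow> gaussian_unit (of_int a + \<i> * of_int b)"
proof -
  have "a\<^sup>2 + b\<^sup>2 \<noteq> - 1"
    using sum_power2_ge_zero[of a b] by linarith
  then show ?thesis
    by (simp add: unimodular_def det_gaussian_matrix gaussian_unit_iff)
qed

text \<open>Comparing real and imaginary parts moves a complex factorization to integer equations,
  the same ones that describe the entries of a product of representing matrices.\<close>

lemma gaussian_mult_eq_iff:
  fixes a b c d e f :: int
  shows "(of_int a + \<i> * of_int b :: complex) = (of_int c + \<i> * of_int d) * (of_int e + \<i> * of_int f)
    \<longleftrightarrow> a = c * e - d * f \<and> b = c * f + d * e"
proof -
  have "(of_int a + \<i> * of_int b :: complex) = (of_int c + \<i> * of_int d) * (of_int e + \<i> * of_int f)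
    \<longleftrightarrow> real_of_int a = of_int (c * e - d * f) \<and> real_of_int b = of_int (c * f + d * e)"
    by (simp add: complex_eq_iff)
  then show ?thesis
    by (simp only: of_int_eq_iff)
qed

lemma gaussian_matrix_mult:
  "gaussian_matrix c d ** gaussian_matrix e f = gaussian_matrix (c * e - d * f) (c * f + d * e)"
  by (simp add: gaussian_matrix_def matrix_matrix_mult_def vec_eq_iff forall_2 sum_2)

lemma gaussian_prime_if_prime_matrix:
  assumes "prime_matrix (gaussian_matrix a b)"
  shows "gaussian_prime (of_int a + \<i> * of_int b)"
  unfolding gaussian_prime_def
proof (intro conjI notI)
  show "of_int a + \<i> * of_int b \<in> gaussian_ints"
    unfolding gaussian_ints_def by blast
  assume "\<exists>u\<in>gaussian_ints. \<exists>v\<in>gaussian_ints.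
    \<not> gaussian_unit u \<and> \<not> gaussian_unit v \<and> of_int a + \<i> * of_int b = u * v"
  then obtain c d e f :: int where
    "\<not> gaussian_unit (of_int c + \<i> * of_int d)" "\<not> gaussian_unit (of_int e + \<i> * of_int f)"
    and "of_int a + \<i> * of_int b = (of_int c + \<i> * of_int d) * (of_int e + \<i> * of_int f)"
    unfolding gaussian_ints_def by blast
  \<comment> \<open>All three facts carry over to the representing matrices, which thus form a
    forbidden factorization.\<close>
  then have "\<not> unimodular (gaussian_matrix c d)" "\<not> unimodular (gaussian_matrix e f)"
    "gaussian_matrix a b = gaussian_matrix c d ** gaussian_matrix e f"
    unfolding unimodular_gaussian_matrix_iff gaussian_mult_eq_iff gaussian_matrix_mult by simp_all
  with assms show False
    unfolding prime_matrix_def by blast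
qed

text \<open>Squares of integers that are at most 3 are 0 or 1, so two of them add up to at most
  2.\<close>

lemma sum_squares_neq_3: "(c::int)\<^sup>2 + d\<^sup>2 \<noteq> 3"
proof
  assume eq: "c\<^sup>2 + d\<^sup>2 = 3"
  have le1: "\<bar>x\<bar> \<le> 1" if "x\<^sup>2 \<le> 3" for x :: int
  proof (rule ccontr)
    assume "\<not> \<bar>x\<bar> \<le> 1"
    then have "2\<^sup>2 \<le> \<bar>x\<bar>\<^sup>2"
      by (intro power_mono) auto
    with that show False by simp
  qed
  have "c\<^sup>2 \<le> 3" "d\<^sup>2 \<le> 3"
    using eq zero_le_power2[of c] zero_le_power2[of d] by linarith+
  then have "c \<in> {-1, 0, 1}" "d \<in> {-1, 0, 1}"
    using le1[of c] le1[of d] by auto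
  with eq show False by auto
qed

text \<open>The zero imaginary part is kept explicit so that \<open>gaussian_mult_eq_iff\<close>
  applies and 3, 0 can serve as witnesses for the failing converse.\<close>

lemma gaussian_prime_3: "gaussian_prime (of_int 3 + \<i> * of_int 0)"
  unfolding gaussian_prime_def
proof (intro conjI notI)
  show "of_int 3 + \<i> * of_int 0 \<in> gaussian_ints"
    unfolding gaussian_ints_def by blast
  assume "\<exists>u\<in>gaussian_ints. \<exists>v\<in>gaussian_ints.
    \<not> gaussian_unit u \<and> \<not> gaussian_unit v \<and> of_int 3 + \<i> * of_int 0 = u * v"
  then obtain c d e f :: int where
    "\<not> gaussian_unit (of_int c + \<i> * of_int d)" "\<not> gaussian_unit (of_int e + \<i> * of_int f)"
    and "of_int 3 + \<i> * of_int 0 = (of_int c + \<i> * of_int d) * (of_int e + \<i> * of_int f)"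
    unfolding gaussian_ints_def by blast
  then have nonunit: "c\<^sup>2 + d\<^sup>2 \<noteq> 1" "e\<^sup>2 + f\<^sup>2 \<noteq> 1"
    and eq: "c * e - d * f = 3" "c * f + d * e = 0"
    unfolding gaussian_unit_iff gaussian_mult_eq_iff by simp_all
  \<comment> \<open>The Brahmagupta-Fibonacci identity: the norm is multiplicative.\<close>
  have "(c\<^sup>2 + d\<^sup>2) * (e\<^sup>2 + f\<^sup>2) = (c * e - d * f)\<^sup>2 + (c * f + d * e)\<^sup>2"
    by algebra
  with eq have prod: "(c\<^sup>2 + d\<^sup>2) * (e\<^sup>2 + f\<^sup>2) = 9"
    by simp
  \<comment> \<open>A norm is nonnegative and a divisor of 9 is at most 9, which leaves finitely
    many cases.\<close>
  have nonneg: "0 \<le> c\<^sup>2 + d\<^sup>2"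
    by simp
  have "c\<^sup>2 + d\<^sup>2 dvd 9"
    using prod by (metis dvd_triv_left)
  then have "c\<^sup>2 + d\<^sup>2 \<le> 9"
    by (rule zdvd_imp_le) simp
  with nonneg have "c\<^sup>2 + d\<^sup>2 \<in> {0, 1, 2, 3, 4, 5, 6, 7, 8, 9}"
    by (simp only: insert_iff empty_iff) presburger
  \<comment> \<open>Only 1, 3 and 9 divide 9. Norm 1 means a unit, 3 is not a sum of two squares,
    and 9 leaves norm 1 for the other factor.\<close>
  moreover note nonunit sum_squares_neq_3[of c d]
  ultimately show False
    using prod by (simp only: insert_iff empty_iff) presburger
qed

lemma not_prime_matrix_3: "\<not> prime_matrix (gaussian_matrix 3 0)"
proof -
  \<comment> \<open>Both factors have determinant 3, a value that no \<open>gaussian_matrix\<close>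
    attains.\<close>
  define B C :: "int ^ 2 ^ 2"
    where "B = vector [vector [3, 0], vector [0, 1]]" and "C = vector [vector [1, 0], vector [0, 3]]"
  have "\<not> unimodular B" "\<not> unimodular C"
    by (simp_all add: unimodular_def B_def C_def det_2)
  moreover have "gaussian_matrix 3 0 = B ** C"
    by (simp add: gaussian_matrix_def B_def C_def matrix_matrix_mult_def vec_eq_iff forall_2 sum_2)
  ultimately show ?thesis
    unfolding prime_matrix_def by blast
qed

theorem proposition6:
  "(\<forall>a b :: int. prime_matrix (gaussian_matrix a b) \<longrightarrow> gaussian_prime (of_int a + \<i> * of_int b)) \<and>
   (\<exists>a b :: int. gaussian_prime (of_int a + \<i> * of_int b) \<and> \<not> prime_matrix (gaussian_matrix a b))"
  using gaussian_prime_if_prime_matrix gaussian_prime_3 not_prime_matrix_3 by blast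

end
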